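(* Let $X$ be a real or complex Hilbert space, let $X_1,\dots,X_n$ be closed subspaces of $X$, and let $P_1,\dots,P_n$ be the orthogonal projections onto $X_1,\dots,X_n$, respectively. Let $\varepsilon_{ij}$, $i\neq j$, $i,j\in\{1,\dots,n\}$, be nonnegative numbers with $\varepsilon_{ij}=\varepsilon_{ji}$ such that $\|P_i x\|\leqslant\varepsilon_{ij}\|x\|$ for all $x\in X_j$, for any distinct $i,j\in\{1,\dots,n\}$. Define the $n\times n$ matrix $E=(e_{ij})$ by $e_{ij}=0$ if $i=j$ and $e_{ij}=\varepsilon_{ij}$ if $i\neq j$, let $r(E)$ be the spectral radius of $E$, and set $A:=P_1+\dots+P_n$. If $r(E)<1$, then the subspaces $X_1,\dots,X_n$ are linearly independent and their sum $X_1+\dots+X_n$ is closed in $X$. Moreover, the sequence of operators $I-(I-A)^N$ converges uniformly (i.e., in operator norm) to the orthogonal projection $P$ onto $X_1+\dots+X_n$ as $N\to\infty$.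
   Context: The sum of subspaces is $X_1+\dots+X_n:=\{x_1+\dots+x_n \mid x_1\in X_1,\dots,x_n\in X_n\}$. The system of subspaces $X_1,\dots,X_n$ is called linearly independent if an equality $x_1+\dots+x_n=0$ with $x_1\in X_1,\dots,x_n\in X_n$ implies $x_1=\dots=x_n=0$. $I$ denotes the identity operator on $X$. *)

theory Defs
  imports "HOL-Analysis.Bounded_Linear_Function" "Jordan_Normal_Form.Spectral_Radius"
begin

text \<open>
  Hilbert spaces over the scalar field \<open>'k\<close>, treated uniformly for real and complex scalars: both
  \<open>real\<close> and \<open>complex\<close> belong to the sort \<open>{real_normed_field, conjugatable_field}\<close>, with
  \<open>conjugate\<close> being the identity and \<open>cnj\<close>, respectively.  Completeness, the norm and the topology
  come from \<open>'a :: banach\<close>; the last two axioms say that the underlying real vector space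
  structure of \<open>'a\<close> is the restriction of \<open>scale\<close>, and that its norm is induced by the inner
  product \<open>ip\<close> (in particular \<open>ip\<close> is positive definite).  The inner product is linear in its
  first argument.
\<close>

locale hilbert_space = vector_space scale
  for scale :: "'k::{real_normed_field, conjugatable_field} \<Rightarrow> 'a::banach \<Rightarrow> 'a" +
  fixes ip :: "'a \<Rightarrow> 'a \<Rightarrow> 'k"
  assumes ip_add_left: "ip (x + y) z = ip x z + ip y z"
    and ip_scale_left: "ip (scale c x) y = c * ip x y"
    and ip_conjugate: "ip y x = conjugate (ip x y)"
    and scale_of_real: "scale (of_real r) x = r *\<^sub>R x"
    and ip_self: "ip x x = of_real ((norm x)\<^sup>2)"

lemma hilbert_space_real:
  "hilbert_space ((*\<^sub>R) :: real \<Rightarrow> 'a \<Rightarrow> 'a :: {real_inner, banach}) (\<bullet>)"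
  by unfold_locales
     (auto simp: inner_add_left inner_add_right inner_commute power2_norm_eq_inner scaleR_right_distrib
       scaleR_left_distrib)

lemma hilbert_space_complex: "hilbert_space ((*) :: complex \<Rightarrow> _) (\<lambda>x y. x * cnj y)"
  by unfold_locales (auto simp: algebra_simps scaleR_conv_of_real complex_norm_square simp del: of_real_power)

text \<open>
  The orthogonal projection onto a subspace \<open>S\<close>: \<open>P x\<close> lies in \<open>S\<close> and \<open>x - P x\<close> is orthogonal
  to \<open>S\<close>.  For a subspace \<open>S\<close> there is at most one such operator.
\<close>

definition is_orth_projection ::
  "('a \<Rightarrow> 'a \<Rightarrow> 'k::zero) \<Rightarrow> 'a::real_normed_vector set \<Rightarrow> ('a \<Rightarrow>\<^sub>L 'a) \<Rightarrow> bool" where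
  "is_orth_projection ip S P \<longleftrightarrow>
     (\<forall>x. blinfun_apply P x \<in> S \<and> (\<forall>y\<in>S. ip (x - blinfun_apply P x) y = 0))"

text \<open>Systems of \<open>n\<close> subspaces are indexed by \<open>0, \<dots>, n - 1\<close>.\<close>

definition subspace_sum :: "nat \<Rightarrow> (nat \<Rightarrow> 'a::comm_monoid_add set) \<Rightarrow> 'a set" where
  "subspace_sum n X = {\<Sum>i<n. x i | x. \<forall>i<n. x i \<in> X i}"

definition lin_indep_subspaces :: "nat \<Rightarrow> (nat \<Rightarrow> 'a::comm_monoid_add set) \<Rightarrow> bool" where
  "lin_indep_subspaces n X \<longleftrightarrow>
     (\<forall>x. (\<forall>i<n. x i \<in> X i) \<and> (\<Sum>i<n. x i) = 0 \<longrightarrow> (\<forall>i<n. x i = 0))"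

text \<open>The matrix has complex entries because \<^const>\<open>spectral_radius\<close> is defined for those.\<close>

definition eps_matrix :: "nat \<Rightarrow> (nat \<Rightarrow> nat \<Rightarrow> real) \<Rightarrow> complex mat" where
  "eps_matrix n \<epsilon> = Matrix.mat n n (\<lambda>(i, j). if i = j then 0 else complex_of_real (\<epsilon> i j))"

definition blinfun_power ::
  "('a::real_normed_vector \<Rightarrow>\<^sub>L 'a) \<Rightarrow> nat \<Rightarrow> ('a \<Rightarrow>\<^sub>L 'a)" where
  "blinfun_power T N = ((\<lambda>S. T o\<^sub>L S) ^^ N) id_blinfun"

end

theory Submission
  imports Defs
begin

text \<open>
  Put \<open>T = I - A\<close>.  On a sum \<open>x = \<Sum>i. x i\<close> with \<open>x i \<in> X i\<close> we have
  \<open>P i x = x i + (\<Sum>j\<noteq>i. P i (x j))\<close>, so \<open>T x\<close> is again such a sum, with the summands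
  \<open>- (\<Sum>j\<noteq>i. P i (x j))\<close>.  The norms of the new summands are bounded by the matrix \<open>E\<close> applied
  to the norms of the old ones, hence the norms after \<open>k\<close> steps by \<open>E\<close> to the power \<open>k\<close>
  (\<open>dominated_by_matrix_power\<close>), and \<open>r(E) < 1\<close> makes them decay like \<open>\<rho> ^ k\<close> for some
  \<open>\<rho> < 1\<close> (\<open>residual_decay\<close>).

  Everything follows from this decay.  If \<open>\<Sum>i. x i = 0\<close>, then the step above leaves every
  \<open>x i\<close> unchanged, so decay forces \<open>x i = 0\<close> (\<open>independent\<close>).  Since
  \<open>I - T ^ N = (\<Sum>k<N. T ^ k A)\<close> and \<open>A z = (\<Sum>i. P i z)\<close>, the operators \<open>I - T ^ N\<close> are the
  partial sums of a series that converges absolutely in operator norm.  Call its limit \<open>Q\<close>.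
  Carried out summand by summand, the series shows that \<open>Q z\<close> lies in \<open>X 0 + \<dots> + X (n - 1)\<close>
  (\<open>Q_in\<close>), because each \<open>X i\<close> is closed; and \<open>Q\<close> fixes that sum pointwise because \<open>T ^ N\<close> tends
  to \<open>0\<close> there (\<open>Q_fix\<close>).  So the sum is the fixed point set of the continuous map \<open>Q\<close>, hence
  closed.  Finally \<open>w = z - Q z = lim (T ^ N z)\<close> satisfies \<open>A w = 0\<close>, that is
  \<open>\<Sum>i. P i w = 0\<close>; by independence every \<open>P i w\<close> vanishes (\<open>P_remainder\<close>).

  The argument up to this point takes place in a Banach space with bounded projections.  The inner
  product enters only at the end: an orthogonal projection fixes its range, and \<open>P i w = 0\<close> means
  that \<open>w\<close> is orthogonal to \<open>X i\<close>, so \<open>Q\<close> is the orthogonal projection onto the sum.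
\<close>

section \<open>Geometric decay of sequences dominated by a matrix\<close>

lemma spectral_radius_smult_less_1:
  assumes M: "M \<in> carrier_mat n n" and "0 < n"
    and \<rho>: "0 < \<rho>" "spectral_radius M < \<rho>"
  shows "spectral_radius (complex_of_real (1 / \<rho>) \<cdot>\<^sub>m M) < 1"
proof -
  let ?B = "complex_of_real (1 / \<rho>) \<cdot>\<^sub>m M"
  have B: "?B \<in> carrier_mat n n" using M by simp
  obtain \<mu> where \<mu>: "\<mu> \<in> spectrum ?B" and r: "spectral_radius ?B = cmod \<mu>"
    using spectral_radius_mem_max(1)[OF B \<open>0 < n\<close>] by auto
  then obtain v where v: "v \<in> carrier_vec n" "v \<noteq> 0\<^sub>v n" and ev: "?B *\<^sub>v v = \<mu> \<cdot>\<^sub>v v"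
    using B unfolding spectrum_def eigenvalue_def eigenvector_def by auto
  have "?B *\<^sub>v v = complex_of_real (1 / \<rho>) \<cdot>\<^sub>v (M *\<^sub>v v)"
    using M v by (intro eq_vecI) (auto simp: scalar_prod_def sum_distrib_left mult.assoc)
  then have "complex_of_real \<rho> \<cdot>\<^sub>v (complex_of_real (1 / \<rho>) \<cdot>\<^sub>v (M *\<^sub>v v)) =
      complex_of_real \<rho> \<cdot>\<^sub>v (\<mu> \<cdot>\<^sub>v v)"
    using ev by simp
  then have "M *\<^sub>v v = (of_real \<rho> * \<mu>) \<cdot>\<^sub>v v"
    using \<rho> by (simp add: smult_smult_assoc flip: of_real_mult)
  then have "of_real \<rho> * \<mu> \<in> spectrum M"
    using v M unfolding spectrum_def eigenvalue_def eigenvector_def by auto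
  then have "cmod (of_real \<rho> * \<mu>) \<le> spectral_radius M"
    using spectral_radius_mem_max(2)[OF M \<open>0 < n\<close>] by blast
  then have "\<rho> * cmod \<mu> \<le> spectral_radius M" using \<rho> by (simp add: norm_mult)
  then have "\<rho> * cmod \<mu> < \<rho> * 1" using \<rho>(2) by linarith
  then have "cmod \<mu> < 1" using \<rho>(1) by (simp only: mult_less_cancel_left_pos)
  then show ?thesis using r by simp
qed

lemma eps_matrix_carrier [simp]: "eps_matrix n \<epsilon> \<in> carrier_mat n n"
  by (simp add: eps_matrix_def)

lemma eps_matrix_dim [simp]: "dim_row (eps_matrix n \<epsilon>) = n" "dim_col (eps_matrix n \<epsilon>) = n"
  by (simp_all add: eps_matrix_def)

lemma eps_matrix_scale:
  "eps_matrix n (\<lambda>i j. \<epsilon> i j / \<rho>) = complex_of_real (1 / \<rho>) \<cdot>\<^sub>m eps_matrix n \<epsilon>"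
  by (rule eq_matI) (auto simp: eps_matrix_def)

text \<open>
  Induction on \<open>k\<close>, applied to the sequence shifted by one step; nonnegativity of the entries of the
  power lets the first step be inserted into the bound for the remaining \<open>k\<close> steps.  The real part
  only serves to come back from the complex matrix to its real entries.
\<close>

lemma dominated_by_matrix_power:
  fixes \<epsilon> :: "nat \<Rightarrow> nat \<Rightarrow> real" and v :: "nat \<Rightarrow> nat \<Rightarrow> real"
  assumes nonneg: "\<And>i j. i < n \<Longrightarrow> j < n \<Longrightarrow> i \<noteq> j \<Longrightarrow> 0 \<le> \<epsilon> i j"
    and step: "\<And>k i. i < n \<Longrightarrow> v (Suc k) i \<le> (\<Sum>j\<in>{..<n} - {i}. \<epsilon> i j * v k j)"
    and "i < n"
  shows "v k i \<le> (\<Sum>j<n. Re ((eps_matrix n \<epsilon> ^\<^sub>m k) $$ (i, j)) * v 0 j)"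
proof -
  let ?E = "eps_matrix n \<epsilon>"
  define e where "e i j = (if i = j then 0 else \<epsilon> i j)" for i j
  have E: "?E $$ (i, j) = of_real (e i j)" if "i < n" "j < n" for i j
    using that by (simp add: eps_matrix_def e_def)
  have e: "0 \<le> e i j" if "i < n" "j < n" for i j
    using that nonneg by (simp add: e_def)
  have pow: "(?E ^\<^sub>m Suc k) $$ (i, l) = (\<Sum>j<n. (?E ^\<^sub>m k) $$ (i, j) * of_real (e j l))"
    if "i < n" "l < n" for k i l
    using that by (simp add: scalar_prod_def E lessThan_atLeast0)
  have Re_pow: "0 \<le> Re ((?E ^\<^sub>m k) $$ (i, l))" if "i < n" "l < n" for k i l
    using that
  proof (induction k arbitrary: i l)
    case 0 then show ?case by (simp add: eps_matrix_def)
  next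
    case (Suc k)
    then show ?case
      by (simp add: pow del: pow_mat.simps) (auto intro!: sum_nonneg mult_nonneg_nonneg e)
  qed
  have v: "v (Suc k) j \<le> (\<Sum>l<n. e j l * v k l)" if "j < n" for k j
  proof -
    have "(\<Sum>l<n. e j l * v k l) = (\<Sum>l\<in>{..<n} - {j}. \<epsilon> j l * v k l)"
      using that by (simp add: sum.remove[of _ j] e_def)
    then show ?thesis using step[OF that, of k] by simp
  qed
  show ?thesis using step \<open>i < n\<close> v
  proof (induction k arbitrary: v i)
    case 0
    have "(\<Sum>j<n. Re ((?E ^\<^sub>m 0) $$ (i, j)) * v 0 j) = (\<Sum>j<n. if j = i then v 0 j else 0)"
      using 0 by (intro sum.cong) (auto simp: eps_matrix_def)
    then show ?case using 0 by (simp add: sum.delta)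
  next
    case (Suc k)
    have "v (Suc k) i \<le> (\<Sum>j<n. Re ((?E ^\<^sub>m k) $$ (i, j)) * v 1 j)"
      using Suc.IH[of "\<lambda>k. v (Suc k)" i] Suc.prems by simp
    also have "\<dots> \<le> (\<Sum>j<n. Re ((?E ^\<^sub>m k) $$ (i, j)) * (\<Sum>l<n. e j l * v 0 l))"
      using Suc.prems by (intro sum_mono mult_left_mono) (auto simp: Re_pow)
    also have "\<dots> = (\<Sum>l<n. (\<Sum>j<n. Re ((?E ^\<^sub>m k) $$ (i, j)) * e j l) * v 0 l)"
      by (simp add: sum_distrib_left sum_distrib_right mult.assoc) (rule sum.swap)
    also have "\<dots> = (\<Sum>l<n. Re ((?E ^\<^sub>m Suc k) $$ (i, l)) * v 0 l)"
      using Suc.prems by (intro sum.cong) (simp_all add: pow del: pow_mat.simps)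
    finally show ?case .
  qed
qed

text \<open>
  A spectral radius below \<open>1\<close> bounds the powers of a matrix, by its Jordan normal form.  To obtain a
  geometric rate, this is applied to \<open>E\<close> divided by a number \<open>\<rho>\<close> strictly between \<open>r(E)\<close> and \<open>1\<close>.
\<close>

lemma dominated_geometric_decay:
  fixes \<epsilon> :: "nat \<Rightarrow> nat \<Rightarrow> real"
  assumes "0 < n"
    and nonneg: "\<And>i j. i < n \<Longrightarrow> j < n \<Longrightarrow> i \<noteq> j \<Longrightarrow> 0 \<le> \<epsilon> i j"
    and radius: "spectral_radius (eps_matrix n \<epsilon>) < 1"
  obtains C \<rho> where "0 < \<rho>" "\<rho> < 1"
    "\<And>v k i. (\<And>k j. j < n \<Longrightarrow> 0 \<le> v k j) \<Longrightarrow>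
       (\<And>k i. i < n \<Longrightarrow> v (Suc k) i \<le> (\<Sum>j\<in>{..<n} - {i}. \<epsilon> i j * v k j)) \<Longrightarrow> i < n \<Longrightarrow>
       v k i \<le> C * \<rho> ^ k * (\<Sum>j<n. v 0 j)"
proof -
  obtain \<rho> where "max 0 (spectral_radius (eps_matrix n \<epsilon>)) < \<rho>" and \<rho>1: "\<rho> < 1"
    using dense[of "max 0 (spectral_radius (eps_matrix n \<epsilon>))" 1] radius by auto
  then have \<rho>: "0 < \<rho>" "spectral_radius (eps_matrix n \<epsilon>) < \<rho>" by auto
  let ?\<delta> = "\<lambda>i j. \<epsilon> i j / \<rho>"
  let ?B = "eps_matrix n ?\<delta>"
  have "spectral_radius ?B < 1"
    unfolding eps_matrix_scale using \<rho> \<open>0 < n\<close> by (intro spectral_radius_smult_less_1[of _ n]) auto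
  then obtain C where C: "\<And>k. norm_bound (?B ^\<^sub>m k) C"
    using spectral_radius_jnf_norm_bound_less_1_upper_triangular[of ?B n] by auto
  show ?thesis
  proof
    fix v :: "nat \<Rightarrow> nat \<Rightarrow> real" and k i
    assume v0: "\<And>k j. j < n \<Longrightarrow> 0 \<le> v k j"
      and v: "\<And>k i. i < n \<Longrightarrow> v (Suc k) i \<le> (\<Sum>j\<in>{..<n} - {i}. \<epsilon> i j * v k j)"
      and i: "i < n"
    \<comment> \<open>Dividing by the power of \<open>\<rho>\<close> turns boundedness of the powers of the rescaled matrix
      into decay.\<close>
    define u where "u k i = v k i / \<rho> ^ k" for k i
    have "u (Suc k) i \<le> (\<Sum>j\<in>{..<n} - {i}. ?\<delta> i j * u k j)" if "i < n" for k i
    proof -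
      have "u (Suc k) i \<le> (\<Sum>j\<in>{..<n} - {i}. \<epsilon> i j * v k j) / \<rho> ^ Suc k"
        unfolding u_def using \<rho> v[OF that] by (intro divide_right_mono) auto
      then show ?thesis by (simp add: u_def sum_divide_distrib)
    qed
    then have "u k i \<le> (\<Sum>j<n. Re ((?B ^\<^sub>m k) $$ (i, j)) * u 0 j)"
      using \<rho> nonneg i by (intro dominated_by_matrix_power) auto
    also have "\<dots> \<le> (\<Sum>j<n. C * u 0 j)"
    proof (intro sum_mono mult_right_mono)
      fix j assume j: "j \<in> {..<n}"
      have "cmod ((?B ^\<^sub>m k) $$ (i, j)) \<le> C"
        using C[of k] i j pow_carrier_mat[OF eps_matrix_carrier[of n ?\<delta>], of k]
        unfolding norm_bound_def by auto
      then show "Re ((?B ^\<^sub>m k) $$ (i, j)) \<le> C"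
        using complex_Re_le_cmod order_trans by blast
      show "0 \<le> u 0 j" using j v0 by (simp add: u_def)
    qed
    finally show "v k i \<le> C * \<rho> ^ k * (\<Sum>j<n. v 0 j)"
      using \<rho> by (simp add: u_def field_simps sum_distrib_left)
  qed (use \<rho> \<rho>1 in auto)
qed


section \<open>Almost orthogonal projections in a Banach space\<close>

text \<open>
  Orthogonality is replaced by what the argument needs of it: each \<open>P i\<close> is a bounded projection
  with range \<open>X i\<close>.
\<close>

locale almost_orthogonal_projections =
  fixes n :: nat and X :: "nat \<Rightarrow> 'a::banach set" and P :: "nat \<Rightarrow> 'a \<Rightarrow>\<^sub>L 'a"
    and \<epsilon> :: "nat \<Rightarrow> nat \<Rightarrow> real"
  assumes n_pos: "0 < n"
    and subspace: "\<And>i. i < n \<Longrightarrow> Real_Vector_Spaces.subspace (X i)"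
    and closed: "\<And>i. i < n \<Longrightarrow> closed (X i)"
    and P_in: "\<And>i x. i < n \<Longrightarrow> P i x \<in> X i"
    and P_fix: "\<And>i x. i < n \<Longrightarrow> x \<in> X i \<Longrightarrow> P i x = x"
    and eps_nonneg: "\<And>i j. i < n \<Longrightarrow> j < n \<Longrightarrow> i \<noteq> j \<Longrightarrow> 0 \<le> \<epsilon> i j"
    and eps_bound: "\<And>i j x. i < n \<Longrightarrow> j < n \<Longrightarrow> i \<noteq> j \<Longrightarrow> x \<in> X j \<Longrightarrow>
                      norm (P i x) \<le> \<epsilon> i j * norm x"
    and radius: "spectral_radius (eps_matrix n \<epsilon>) < 1"
begin

definition A :: "'a \<Rightarrow>\<^sub>L 'a" where "A = (\<Sum>i<n. P i)"

definition T :: "'a \<Rightarrow>\<^sub>L 'a" where "T = id_blinfun - A"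

text \<open>The map that \<open>T\<close> induces on families of summands: see \<open>T_sum\<close>.\<close>

definition residual :: "(nat \<Rightarrow> 'a) \<Rightarrow> nat \<Rightarrow> 'a" where
  "residual x i = - (\<Sum>j\<in>{..<n} - {i}. P i (x j))"

lemma A_apply: "A x = (\<Sum>i<n. P i x)"
  by (simp add: A_def blinfun.sum_left)

lemma T_apply: "T x = x - A x"
  by (simp add: T_def blinfun.diff_left)

lemma residual_cong: "(\<And>j. j < n \<Longrightarrow> x j = y j) \<Longrightarrow> residual x i = residual y i"
  by (simp add: residual_def)

lemma residual_in: "i < n \<Longrightarrow> residual x i \<in> X i"
  unfolding residual_def by (intro real_vector.subspace_neg real_vector.subspace_sum subspace P_in)

lemma P_sum:
  assumes "\<forall>i<n. x i \<in> X i" "i < n"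
  shows "P i (\<Sum>j<n. x j) = x i - residual x i"
proof -
  have "P i (\<Sum>j<n. x j) = (\<Sum>j<n. P i (x j))" by (rule blinfun.sum_right)
  also have "\<dots> = P i (x i) + (\<Sum>j\<in>{..<n} - {i}. P i (x j))"
    using assms by (intro sum.remove) auto
  finally show ?thesis using assms by (simp add: P_fix residual_def)
qed

lemma T_sum:
  assumes "\<forall>i<n. x i \<in> X i"
  shows "T (\<Sum>i<n. x i) = (\<Sum>i<n. residual x i)"
  using assms by (simp add: T_apply A_apply P_sum sum_subtractf)

lemma residual_power_in:
  assumes "\<forall>i<n. x i \<in> X i"
  shows "\<forall>i<n. (residual ^^ k) x i \<in> X i"
  using assms residual_in by (cases k) auto

lemma T_power_sum:
  assumes "\<forall>i<n. x i \<in> X i"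
  shows "(blinfun_apply T ^^ k) (\<Sum>i<n. x i) = (\<Sum>i<n. (residual ^^ k) x i)"
  by (induction k) (simp_all add: T_sum residual_power_in assms)

lemma norm_residual_le:
  assumes "\<forall>i<n. x i \<in> X i" "i < n"
  shows "norm (residual x i) \<le> (\<Sum>j\<in>{..<n} - {i}. \<epsilon> i j * norm (x j))"
  unfolding residual_def norm_minus_cancel using assms
  by (intro sum_norm_le eps_bound) auto

lemma residual_decay:
  obtains C \<rho> where "0 < \<rho>" "\<rho> < 1"
    "\<And>x k i. \<forall>i<n. x i \<in> X i \<Longrightarrow> i < n \<Longrightarrow>
       norm ((residual ^^ k) x i) \<le> C * \<rho> ^ k * (\<Sum>j<n. norm (x j))"
proof (rule dominated_geometric_decay[of n \<epsilon>])
  fix C \<rho> :: real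
  assume \<rho>: "0 < \<rho>" "\<rho> < 1"
    and decay: "\<And>v k i. (\<And>k j. j < n \<Longrightarrow> 0 \<le> v k j) \<Longrightarrow>
       (\<And>k i. i < n \<Longrightarrow> v (Suc k) i \<le> (\<Sum>j\<in>{..<n} - {i}. \<epsilon> i j * v k j)) \<Longrightarrow> i < n \<Longrightarrow>
       v k i \<le> C * \<rho> ^ k * (\<Sum>j<n. v 0 j)"
  show ?thesis
  proof (rule that[OF \<rho>])
    fix x :: "nat \<Rightarrow> 'a" and k i
    assume "\<forall>i<n. x i \<in> X i" "i < n"
    then show "norm ((residual ^^ k) x i) \<le> C * \<rho> ^ k * (\<Sum>j<n. norm (x j))"
      using decay[of "\<lambda>k i. norm ((residual ^^ k) x i)" i k]
      by (simp add: norm_residual_le residual_power_in)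
  qed
qed (simp_all add: n_pos eps_nonneg radius)

lemma residual_power_summable:
  assumes "\<forall>i<n. x i \<in> X i" "i < n"
  shows "summable (\<lambda>k. (residual ^^ k) x i)"
proof -
  obtain C \<rho> where \<rho>: "0 < \<rho>" "\<rho> < 1" and decay:
    "\<And>x k i. \<forall>i<n. x i \<in> X i \<Longrightarrow> i < n \<Longrightarrow>
       norm ((residual ^^ k) x i) \<le> C * \<rho> ^ k * (\<Sum>j<n. norm (x j))"
    by (rule residual_decay) blast
  show ?thesis
  proof (rule summable_comparison_test')
    show "summable (\<lambda>k. C * \<rho> ^ k * (\<Sum>j<n. norm (x j)))"
      using \<rho> by (intro summable_mult summable_mult2 summable_geometric) auto
    show "norm ((residual ^^ k) x i) \<le> C * \<rho> ^ k * (\<Sum>j<n. norm (x j))" if "0 \<le> k" for k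
      using decay assms by blast
  qed
qed

text \<open>
  The summands of a representation of \<open>0\<close> form a fixed point of \<open>residual\<close>, whose iterates tend
  to \<open>0\<close>.
\<close>

lemma independent: "lin_indep_subspaces n X"
  unfolding lin_indep_subspaces_def
proof (intro allI impI, elim conjE)
  fix x i assume x: "\<forall>i<n. x i \<in> X i" and sum0: "(\<Sum>i<n. x i) = 0" and i: "i < n"
  have fixed: "residual x j = x j" if "j < n" for j
  proof -
    have "x j - residual x j = P j 0" using P_sum[OF x that] by (simp only: sum0)
    then show ?thesis by (simp only: blinfun.zero_right right_minus_eq)
  qed
  have "(residual ^^ k) x j = x j" if "j < n" for j k
    using that
  proof (induction k arbitrary: j)
    case (Suc k)
    have "residual ((residual ^^ k) x) j = residual x j"
      by (rule residual_cong) (rule Suc.IH)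
    then show ?case using fixed[OF Suc.prems] by simp
  qed simp
  then have const: "(\<lambda>k. (residual ^^ k) x i) = (\<lambda>k. x i)" using i by blast
  have "(\<lambda>k. x i) \<longlonglongrightarrow> 0"
    using summable_LIMSEQ_zero[OF residual_power_summable[OF x i]] by (simp only: const)
  then show "x i = 0" by (rule LIMSEQ_unique[OF tendsto_const])
qed

lemma blinfun_power_apply: "blinfun_apply (blinfun_power S k) = blinfun_apply S ^^ k"
  by (induction k) (simp_all add: blinfun_power_def fun_eq_iff)

lemma T_power_A_apply: "(blinfun_apply T ^^ k) (A z) = (\<Sum>i<n. (residual ^^ k) (\<lambda>i. P i z) i)"
  unfolding A_apply by (intro T_power_sum allI impI P_in)

lemma telescope: "id_blinfun - blinfun_power T N = (\<Sum>k<N. blinfun_power T k o\<^sub>L A)"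
proof (rule blinfun_eqI)
  fix z
  have "z - (blinfun_apply T ^^ N) z = (\<Sum>k<N. (blinfun_apply T ^^ k) (A z))"
  proof (induction N)
    case (Suc N)
    have "(blinfun_apply T ^^ N) (A z) = (blinfun_apply T ^^ N) (z - T z)" by (simp add: T_apply)
    also have "\<dots> = (blinfun_apply T ^^ N) z - (blinfun_apply T ^^ N) (T z)"
      unfolding blinfun_power_apply[symmetric] by (rule blinfun.diff_right)
    also have "\<dots> = (blinfun_apply T ^^ N) z - (blinfun_apply T ^^ Suc N) z"
      by (simp add: funpow_swap1)
    finally have "(blinfun_apply T ^^ N) (A z) =
      (blinfun_apply T ^^ N) z - (blinfun_apply T ^^ Suc N) z" .
    then show ?case using Suc.IH by (simp only: sum.lessThan_Suc) (simp add: algebra_simps)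
  qed simp
  then show "(id_blinfun - blinfun_power T N) z = (\<Sum>k<N. blinfun_power T k o\<^sub>L A) z"
    by (simp add: blinfun.diff_left blinfun.sum_left blinfun_power_apply)
qed

text \<open>
  The decay of the summands starting from \<open>P i z\<close> is uniform over \<open>norm z \<le> 1\<close>, since
  \<open>norm (P i z) \<le> norm (P i) * norm z\<close>; so it bounds the operator norms.
\<close>

lemma summable_T_power_A: "summable (\<lambda>k. blinfun_power T k o\<^sub>L A)"
proof -
  obtain C \<rho> where \<rho>: "0 < \<rho>" "\<rho> < 1" and decay:
    "\<And>x k i. \<forall>i<n. x i \<in> X i \<Longrightarrow> i < n \<Longrightarrow>
       norm ((residual ^^ k) x i) \<le> C * \<rho> ^ k * (\<Sum>j<n. norm (x j))"
    by (rule residual_decay) blast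
  define K where "K = \<bar>C\<bar> * (\<Sum>j<n. norm (P j))"
  have K: "0 \<le> K" by (simp add: K_def sum_nonneg)
  show ?thesis
  proof (rule summable_comparison_test')
    show "summable (\<lambda>k. (real n * K) * \<rho> ^ k)"
      using \<rho> by (intro summable_mult summable_geometric) auto
    fix k :: nat
    show "norm (blinfun_power T k o\<^sub>L A) \<le> (real n * K) * \<rho> ^ k"
    proof (rule norm_blinfun_bound)
      fix z
      have "norm ((residual ^^ k) (\<lambda>i. P i z) i) \<le> K * \<rho> ^ k * norm z" if "i < n" for i
      proof -
        have "norm ((residual ^^ k) (\<lambda>i. P i z) i) \<le> C * \<rho> ^ k * (\<Sum>j<n. norm (P j z))"
          using decay that P_in by simp
        also have "\<dots> \<le> \<bar>C\<bar> * \<rho> ^ k * (\<Sum>j<n. norm (P j) * norm z)"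
          using \<rho> by (intro mult_mono sum_mono norm_blinfun sum_nonneg) auto
        also have "\<dots> = K * \<rho> ^ k * norm z"
          by (simp add: K_def flip: sum_distrib_right)
        finally show ?thesis .
      qed
      then have "norm (\<Sum>i<n. (residual ^^ k) (\<lambda>i. P i z) i) \<le> (\<Sum>i<n. K * \<rho> ^ k * norm z)"
        by (intro sum_norm_le) auto
      then show "norm ((blinfun_power T k o\<^sub>L A) z) \<le> (real n * K) * \<rho> ^ k * norm z"
        by (simp add: blinfun_power_apply T_power_A_apply mult.assoc)
    qed (use K \<rho> in auto)
  qed
qed

definition Q :: "'a \<Rightarrow>\<^sub>L 'a" where "Q = (\<Sum>k. blinfun_power T k o\<^sub>L A)"

lemma convergence: "(\<lambda>N. id_blinfun - blinfun_power T N) \<longlonglongrightarrow> Q"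
  unfolding telescope Q_def by (rule summable_LIMSEQ[OF summable_T_power_A])

lemma T_power_tendsto: "(\<lambda>N. (blinfun_apply T ^^ N) z) \<longlonglongrightarrow> z - Q z"
proof -
  have "(\<lambda>N. (id_blinfun - blinfun_power T N) z) \<longlonglongrightarrow> Q z"
    by (rule blinfun.tendsto[OF convergence tendsto_const])
  then have "(\<lambda>N. z - (id_blinfun - blinfun_power T N) z) \<longlonglongrightarrow> z - Q z"
    by (rule tendsto_diff[OF tendsto_const])
  then show ?thesis by (simp add: blinfun.diff_left blinfun_power_apply)
qed

lemma Q_fix:
  assumes "z \<in> subspace_sum n X"
  shows "Q z = z"
proof -
  obtain x where x: "\<forall>i<n. x i \<in> X i" and z: "z = (\<Sum>i<n. x i)"
    using assms unfolding subspace_sum_def by auto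
  have "(\<lambda>k. \<Sum>i<n. (residual ^^ k) x i) \<longlonglongrightarrow> (\<Sum>i<n. 0)"
    using x by (intro tendsto_sum summable_LIMSEQ_zero residual_power_summable) auto
  then have "(\<lambda>k. (blinfun_apply T ^^ k) z) \<longlonglongrightarrow> 0" using T_power_sum[OF x] z by simp
  then show ?thesis using LIMSEQ_unique[OF T_power_tendsto[of z]] by fastforce
qed

text \<open>
  Before the sum is known to be closed, a limit of its elements need not lie in it.  Hence the series
  for \<open>Q z\<close> is summed separately in each of the closed subspaces \<open>X i\<close>.
\<close>

lemma Q_in: "Q z \<in> subspace_sum n X"
proof -
  let ?y = "\<lambda>k. (residual ^^ k) (\<lambda>i. P i z)"
  have y: "\<forall>i<n. ?y k i \<in> X i" for k using residual_power_in[of "\<lambda>i. P i z"] P_in by simp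
  have summable: "summable (\<lambda>k. ?y k i)" if "i < n" for i
    using residual_power_summable[of "\<lambda>i. P i z"] P_in that by simp
  have "Q z = (\<Sum>k. (blinfun_power T k o\<^sub>L A) z)"
    unfolding Q_def
    by (rule bounded_linear.suminf[OF blinfun.bounded_linear_left summable_T_power_A])
  also have "\<dots> = (\<Sum>k. \<Sum>i<n. ?y k i)"
    by (simp add: blinfun_power_apply T_power_A_apply)
  also have "\<dots> = (\<Sum>i<n. \<Sum>k. ?y k i)"
    using summable by (intro suminf_sum) auto
  finally have Q: "Q z = (\<Sum>i<n. \<Sum>k. ?y k i)" .
  have "(\<Sum>k. ?y k i) \<in> X i" if "i < n" for i
  proof (rule closed_sequentially[OF closed[OF that]])
    show "(\<lambda>N. \<Sum>k<N. ?y k i) \<longlonglongrightarrow> (\<Sum>k. ?y k i)" by (rule summable_LIMSEQ[OF summable[OF that]])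
    show "(\<Sum>k<N. ?y k i) \<in> X i" for N
      using y that by (intro real_vector.subspace_sum subspace) auto
  qed
  then show ?thesis unfolding subspace_sum_def using Q by blast
qed

lemma closed_sum: "closed (subspace_sum n X)"
proof -
  have "subspace_sum n X = {z. Q z = z}"
  proof (intro equalityI subsetI)
    fix z assume "z \<in> {z. Q z = z}"
    then show "z \<in> subspace_sum n X" using Q_in[of z] by simp
  qed (simp add: Q_fix)
  then show ?thesis by (simp add: closed_Collect_eq continuous_intros)
qed

text \<open>
  The limit \<open>z - Q z\<close> of \<open>T ^ N z\<close> is a fixed point of \<open>T = I - A\<close>, so \<open>A\<close> annihilates it, and
  linear independence separates the vanishing sum \<open>A (z - Q z)\<close> into its terms.
\<close>

lemma P_remainder:
  assumes "i < n"
  shows "P i (z - Q z) = 0"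
proof -
  let ?w = "z - Q z"
  have "(\<lambda>N. A ((blinfun_apply T ^^ N) z)) \<longlonglongrightarrow> A ?w"
    by (rule blinfun.tendsto[OF tendsto_const T_power_tendsto])
  moreover have "(\<lambda>N. (blinfun_apply T ^^ N) z - (blinfun_apply T ^^ Suc N) z) \<longlonglongrightarrow> ?w - ?w"
    by (intro tendsto_diff T_power_tendsto LIMSEQ_Suc)
  then have "(\<lambda>N. A ((blinfun_apply T ^^ N) z)) \<longlonglongrightarrow> 0" by (simp add: T_apply)
  ultimately have "A ?w = 0" by (rule LIMSEQ_unique)
  then have "(\<Sum>i<n. P i ?w) = 0" by (simp only: A_apply)
  then show ?thesis
    using independent[unfolded lin_indep_subspaces_def, rule_format, of "\<lambda>i. P i ?w" i] assms P_in
    by simp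
qed

end


section \<open>Orthogonal projections in a Hilbert space\<close>

context hilbert_space
begin

lemma ip_add_right: "ip x (y + z) = ip x y + ip x z"
  by (metis ip_add_left ip_conjugate conjugate_dist_add)

lemma ip_zero_right: "ip x 0 = 0"
  by (metis ip_add_right add_cancel_right_right)

lemma ip_sum_right: "finite I \<Longrightarrow> ip x (\<Sum>i\<in>I. f i) = (\<Sum>i\<in>I. ip x (f i))"
  by (induction I rule: finite_induct) (simp_all add: ip_zero_right ip_add_right)

text \<open>Turns a subspace over \<open>'k\<close> into a real one, as the Banach space part works with real scalars.\<close>

lemma real_subspace: "subspace S \<Longrightarrow> Real_Vector_Spaces.subspace S"
  by (metis real_vector.subspaceI subspace_0 subspace_add subspace_scale scale_of_real)

text \<open>For \<open>x\<close> in \<open>S\<close> the difference \<open>x - P x\<close> lies in \<open>S\<close> and is orthogonal to \<open>S\<close>, hence to itself.\<close>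

lemma orth_projection_fix:
  assumes "is_orth_projection ip S P" "subspace S" "x \<in> S"
  shows "blinfun_apply P x = x"
proof -
  have "ip (x - blinfun_apply P x) (x - blinfun_apply P x) = 0"
    using assms by (simp add: is_orth_projection_def subspace_diff)
  then show ?thesis by (simp add: ip_self)
qed

end

theorem theorem2p1:
  fixes scale :: "'k::{real_normed_field, conjugatable_field} \<Rightarrow> 'a::banach \<Rightarrow> 'a"
    and ip :: "'a \<Rightarrow> 'a \<Rightarrow> 'k"
    and n :: nat
    and X :: "nat \<Rightarrow> 'a set"
    and P :: "nat \<Rightarrow> 'a \<Rightarrow>\<^sub>L 'a"
    and \<epsilon> :: "nat \<Rightarrow> nat \<Rightarrow> real"
    and A :: "'a \<Rightarrow>\<^sub>L 'a"
  assumes hilbert: "hilbert_space scale ip"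
    and n: "n \<ge> 1"
    and subspace: "\<And>i. i < n \<Longrightarrow> module.subspace scale (X i)"
    and closed: "\<And>i. i < n \<Longrightarrow> closed (X i)"
    and proj: "\<And>i. i < n \<Longrightarrow> is_orth_projection ip (X i) (P i)"
    and eps_nonneg: "\<And>i j. i < n \<Longrightarrow> j < n \<Longrightarrow> i \<noteq> j \<Longrightarrow> 0 \<le> \<epsilon> i j"
    and eps_sym: "\<And>i j. i < n \<Longrightarrow> j < n \<Longrightarrow> i \<noteq> j \<Longrightarrow> \<epsilon> i j = \<epsilon> j i"
    and eps_bound: "\<And>i j x. i < n \<Longrightarrow> j < n \<Longrightarrow> i \<noteq> j \<Longrightarrow> x \<in> X j \<Longrightarrow>
                      norm (blinfun_apply (P i) x) \<le> \<epsilon> i j * norm x"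
    and A: "A = (\<Sum>i<n. P i)"
    and radius: "spectral_radius (eps_matrix n \<epsilon>) < 1"
  shows "lin_indep_subspaces n X \<and> closed (subspace_sum n X) \<and>
         (\<exists>Q. is_orth_projection ip (subspace_sum n X) Q \<and>
              (\<lambda>N. id_blinfun - blinfun_power (id_blinfun - A) N) \<longlonglongrightarrow> Q)"
proof -
  interpret H: hilbert_space scale ip by (rule hilbert)
  interpret S: almost_orthogonal_projections n X P \<epsilon>
  proof
    show "blinfun_apply (P i) x \<in> X i" if "i < n" for i x
      using proj[OF that] by (simp add: is_orth_projection_def)
    show "blinfun_apply (P i) x = x" if "i < n" "x \<in> X i" for i x
      using H.orth_projection_fix proj subspace that by blast
  qed (use n H.real_subspace subspace closed eps_nonneg eps_bound radius in auto)
  have "is_orth_projection ip (subspace_sum n X) S.Q"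
    unfolding is_orth_projection_def
  proof (intro allI conjI ballI)
    fix z y
    show "S.Q z \<in> subspace_sum n X" by (rule S.Q_in)
    assume "y \<in> subspace_sum n X"
    then obtain x where x: "\<forall>i<n. x i \<in> X i" and y: "y = (\<Sum>i<n. x i)"
      unfolding subspace_sum_def by auto
    have "ip (z - S.Q z) (x i) = 0" if "i < n" for i
    proof -
      have "ip ((z - S.Q z) - P i (z - S.Q z)) (x i) = 0"
        using proj[OF that] x that unfolding is_orth_projection_def by blast
      then show ?thesis by (simp add: S.P_remainder[OF that])
    qed
    then show "ip (z - S.Q z) y = 0" by (simp add: y H.ip_sum_right)
  qed
  moreover have "(\<lambda>N. id_blinfun - blinfun_power (id_blinfun - A) N) \<longlonglongrightarrow> S.Q"
    using S.convergence by (simp add: S.T_def S.A_def A)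
  ultimately show ?thesis using S.independent S.closed_sum by blast
qed

end
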